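(* For any function $f\in L^2(\nu)$ and any $n\in\mathbb N$, $$(I-P)(f)\circ X_n\ \perp\ \big(P(f)\circ X_n-f\circ X_{n+1}\big)$$ in the dissipation space $Diss$.
   Context: $(V,\mathcal B,\mu)$ is a standard Borel space with a non-atomic infinite $\sigma$-finite measure $\mu$. $\rho$ is a $\sigma$-finite symmetric measure on $(V\times V,\mathcal B\times\mathcal B)$, i.e. $\rho(A\times B)=\rho(B\times A)$ for all $A,B\in\mathcal B$, supported by a symmetric Borel set $E\subset V\times V$, and disintegrated with respect to $\mu$: there is a measurable family $x\mapsto\rho_x$ of measures on $(V,\mathcal B)$, with $\rho_x$ supported by $E_x=\{y:(x,y)\in E\}$, such that $\iint f\,d\rho=\int_V\big(\int_V f(x,y)\,d\rho_x(y)\big)d\mu(x)$. The measure $\rho$ is irreducible: for $\mu$-a.e. $x$, $E_x$ is nonempty and uncountable and $(E_x,\rho_x)$ is a standard (non-atomic) measure space. Put $c(x)=\rho_x(V)$; it is assumed that $0<c(x)<\infty$ for $\mu$-a.e. $x$ and $\int_A c\,d\mu<\infty$ whenever $\mu(A)<\infty$. The measure $\nu$ is $d\nu=c\,d\mu$. The Markov operator is $P(f)(x)=\int_V f(y)\,P(x,dy)$, with $P(x,dy)=c(x)^{-1}d\rho_x(y)$. Path space: $\Omega=V^{\mathbb N_0}$ with the $\sigma$-algebra $\mathcal C$ generated by cylinder sets, $X_n(\omega)=\omega_n$, $\Omega_x=\{\omega:X_0(\omega)=x\}$; $\mathbb P_x$ is the probability measure on $\Omega_x$ with $\mathbb P_x(X_1\in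 A_1,\dots,X_n\in A_n)=\int_{A_1}\cdots\int_{A_n}P(y_{n-1},dy_n)\cdots P(x,dy_1)$. Let $\lambda=\int_V\mathbb P_x\,d\nu(x)$, a $\sigma$-finite measure on $\Omega$. The dissipation space $Diss$ is $L^2(\Omega,\lambda)$ with rescaled inner product $\langle f,g\rangle_{\mathcal D}=\frac12\int_V\int_{\Omega_x}f(\omega)g(\omega)\,d\mathbb P_x(\omega)\,d\nu(x)$. *)

theory Defs
  imports "HOL-Probability.Probability"
begin

section \<open>Standard measure spaces\<close>

text \<open>
  The ambient set is \<^term>\<open>space M\<close>, so the topology is a set-based one rather than
  an instance of the class \<^class>\<open>polish_space\<close>.
\<close>

definition standard_borel :: "'a measure \<Rightarrow> bool" where
  "standard_borel M \<longleftrightarrow>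
     (\<exists>T. completely_metrizable_space T \<and> second_countable T \<and> topspace T = space M \<and>
          sets M = sigma_sets (space M) {U. openin T U})"

definition non_atomic :: "'a measure \<Rightarrow> bool" where
  "non_atomic M \<longleftrightarrow>
     \<not> (\<exists>A\<in>sets M. 0 < emeasure M A \<and>
          (\<forall>B\<in>sets M. B \<subseteq> A \<longrightarrow> emeasure M B = 0 \<or> emeasure M (A - B) = 0))"

definition standard_measure_space :: "'a measure \<Rightarrow> bool" where
  "standard_measure_space M \<longleftrightarrow> standard_borel M \<and> sigma_finite_measure M \<and> non_atomic M"


section \<open>Symmetric measures, transition kernel and Markov operator\<close>

text \<open>
  The disintegration \<open>x \<mapsto> \<rho>\<^sub>x\<close> of \<open>\<rho>\<close> is written \<open>\<kappa>\<close> below.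
\<close>

definition c_fun :: "'a measure \<Rightarrow> ('a \<Rightarrow> 'a measure) \<Rightarrow> 'a \<Rightarrow> ennreal" where
  "c_fun \<mu> \<kappa> x = emeasure (\<kappa> x) (space \<mu>)"

locale symmetric_measure =
  fixes \<mu> :: "'a measure" and \<rho> :: "('a \<times> 'a) measure" and E :: "('a \<times> 'a) set"
    and \<kappa> :: "'a \<Rightarrow> 'a measure"
  assumes standard: "standard_measure_space \<mu>"
    and infinite: "emeasure \<mu> (space \<mu>) = \<infinity>"
    and sets_\<rho>: "sets \<rho> = sets (\<mu> \<Otimes>\<^sub>M \<mu>)"
    and sigma_finite_\<rho>: "sigma_finite_measure \<rho>"
    and symmetric: "\<And>A B. A \<in> sets \<mu> \<Longrightarrow> B \<in> sets \<mu> \<Longrightarrow> emeasure \<rho> (A \<times> B) = emeasure \<rho> (B \<times> A)"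
    and sets_E: "E \<in> sets (\<mu> \<Otimes>\<^sub>M \<mu>)"
    and sym_E: "sym E"
    and support_\<rho>: "emeasure \<rho> (space \<rho> - E) = 0"
    and sets_\<kappa>: "\<And>x. x \<in> space \<mu> \<Longrightarrow> sets (\<kappa> x) = sets \<mu>"
    and measurable_\<kappa>: "\<And>A. A \<in> sets \<mu> \<Longrightarrow> (\<lambda>x. emeasure (\<kappa> x) A) \<in> borel_measurable \<mu>"
    and support_\<kappa>: "\<And>x. x \<in> space \<mu> \<Longrightarrow> emeasure (\<kappa> x) (space \<mu> - E `` {x}) = 0"
    and disintegration: "\<And>g. g \<in> borel_measurable (\<mu> \<Otimes>\<^sub>M \<mu>) \<Longrightarrow>
           (\<integral>\<^sup>+z. g z \<partial>\<rho>) = (\<integral>\<^sup>+x. (\<integral>\<^sup>+y. g (x, y) \<partial>\<kappa> x) \<partial>\<mu>)"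
    and irreducible: "AE x in \<mu>. E `` {x} \<noteq> {} \<and> uncountable (E `` {x}) \<and>
           standard_measure_space (restrict_space (\<kappa> x) (E `` {x}))"
    and c_pos_finite: "AE x in \<mu>. 0 < c_fun \<mu> \<kappa> x \<and> c_fun \<mu> \<kappa> x < \<infinity>"
    and c_locally_integrable:
      "\<And>A. A \<in> sets \<mu> \<Longrightarrow> emeasure \<mu> A < \<infinity> \<Longrightarrow> (\<integral>\<^sup>+x\<in>A. c_fun \<mu> \<kappa> x \<partial>\<mu>) < \<infinity>"

definition nu_measure :: "'a measure \<Rightarrow> ('a \<Rightarrow> 'a measure) \<Rightarrow> 'a measure" where
  "nu_measure \<mu> \<kappa> = density \<mu> (c_fun \<mu> \<kappa>)"

text \<open>
  \<open>c\<close> is positive and finite only almost everywhere.  On the exceptional null set \<open>P(x, \<cdot>)\<close> is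
  set to the point mass at \<open>x\<close>, so that it is a probability kernel everywhere; this affects
  neither \<open>\<lambda>\<close> below nor the classes of \<open>P f\<close> and \<open>P f \<circ> X\<^sub>n\<close>.
\<close>

definition transition :: "'a measure \<Rightarrow> ('a \<Rightarrow> 'a measure) \<Rightarrow> 'a \<Rightarrow> 'a measure" where
  "transition \<mu> \<kappa> x =
     (if 0 < c_fun \<mu> \<kappa> x \<and> c_fun \<mu> \<kappa> x < \<infinity>
      then scale_measure (inverse (c_fun \<mu> \<kappa> x)) (\<kappa> x) else return \<mu> x)"

definition markov_op :: "'a measure \<Rightarrow> ('a \<Rightarrow> 'a measure) \<Rightarrow> ('a \<Rightarrow> real) \<Rightarrow> 'a \<Rightarrow> real" where
  "markov_op \<mu> \<kappa> f x = (\<integral>y. f y \<partial>transition \<mu> \<kappa> x)"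


section \<open>Path space\<close>

abbreviation path_space :: "'a measure \<Rightarrow> (nat \<Rightarrow> 'a) measure" where
  "path_space M \<equiv> Pi\<^sub>M UNIV (\<lambda>_. M)"

definition X :: "nat \<Rightarrow> (nat \<Rightarrow> 'a) \<Rightarrow> 'a" where
  "X n \<omega> = \<omega> n"

definition paths_from :: "'a measure \<Rightarrow> 'a \<Rightarrow> (nat \<Rightarrow> 'a) set" where
  "paths_from M x = {\<omega> \<in> space (path_space M). X 0 \<omega> = x}"

text \<open>\<open>iterated K [A\<^sub>1, \<dots>, A\<^sub>n] x = \<integral>\<^bsub>A\<^sub>1\<^esub> \<dots> \<integral>\<^bsub>A\<^sub>n\<^esub> K(y\<^bsub>n-1\<^esub>, dy\<^sub>n) \<dots> K(x, dy\<^sub>1)\<close>.\<close>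

primrec iterated :: "('a \<Rightarrow> 'a measure) \<Rightarrow> 'a set list \<Rightarrow> 'a \<Rightarrow> ennreal" where
  "iterated K [] x = 1"
| "iterated K (A # As) x = (\<integral>\<^sup>+y\<in>A. iterated K As y \<partial>K x)"

definition cylinder :: "'a measure \<Rightarrow> 'a set list \<Rightarrow> (nat \<Rightarrow> 'a) set" where
  "cylinder M As = {\<omega> \<in> space (path_space M). \<forall>i<length As. X (Suc i) \<omega> \<in> As ! i}"

definition is_path_measure ::
    "'a measure \<Rightarrow> ('a \<Rightarrow> 'a measure) \<Rightarrow> 'a \<Rightarrow> (nat \<Rightarrow> 'a) measure \<Rightarrow> bool" where
  "is_path_measure M K x Q \<longleftrightarrow>
     prob_space Q \<and> sets Q = sets (path_space M) \<and> emeasure Q (paths_from M x) = 1 \<and>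
     (\<forall>As\<in>lists (sets M). emeasure Q (cylinder M As) = iterated K As x)"

definition path_measure :: "'a measure \<Rightarrow> ('a \<Rightarrow> 'a measure) \<Rightarrow> 'a \<Rightarrow> (nat \<Rightarrow> 'a) measure" where
  "path_measure \<mu> \<kappa> x = (THE Q. is_path_measure \<mu> (transition \<mu> \<kappa>) x Q)"

text \<open>
  The monadic bind makes sense for the infinite measure \<open>\<nu>\<close> as well: see
  \<open>emeasure_path_lambda\<close> below.
\<close>

definition path_lambda :: "'a measure \<Rightarrow> ('a \<Rightarrow> 'a measure) \<Rightarrow> (nat \<Rightarrow> 'a) measure" where
  "path_lambda \<mu> \<kappa> = nu_measure \<mu> \<kappa> \<bind> path_measure \<mu> \<kappa>"


section \<open>The dissipation space\<close>

text \<open>Elements of \<open>L\<^sup>2\<close> are given by representatives.\<close>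

definition L2 :: "'b measure \<Rightarrow> ('b \<Rightarrow> real) set" where
  "L2 M = {f \<in> borel_measurable M. integrable M (\<lambda>x. (f x)\<^sup>2)}"

definition Diss :: "'a measure \<Rightarrow> ('a \<Rightarrow> 'a measure) \<Rightarrow> ((nat \<Rightarrow> 'a) \<Rightarrow> real) set" where
  "Diss \<mu> \<kappa> = L2 (path_lambda \<mu> \<kappa>)"

definition Diss_inner ::
    "'a measure \<Rightarrow> ('a \<Rightarrow> 'a measure) \<Rightarrow> ((nat \<Rightarrow> 'a) \<Rightarrow> real) \<Rightarrow> ((nat \<Rightarrow> 'a) \<Rightarrow> real) \<Rightarrow> real" where
  "Diss_inner \<mu> \<kappa> f g =
     1/2 * (\<integral>x. (LINT \<omega>:paths_from \<mu> x|path_measure \<mu> \<kappa> x. f \<omega> * g \<omega>) \<partial>nu_measure \<mu> \<kappa>)"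

definition Diss_orthogonal ::
    "'a measure \<Rightarrow> ('a \<Rightarrow> 'a measure) \<Rightarrow> ((nat \<Rightarrow> 'a) \<Rightarrow> real) \<Rightarrow> ((nat \<Rightarrow> 'a) \<Rightarrow> real) \<Rightarrow> bool" where
  "Diss_orthogonal \<mu> \<kappa> f g \<longleftrightarrow> f \<in> Diss \<mu> \<kappa> \<and> g \<in> Diss \<mu> \<kappa> \<and> Diss_inner \<mu> \<kappa> f g = 0"


section \<open>Well-definedness of the path measures\<close>

lemma standard_borel_singleton:
  assumes "standard_borel M" "x \<in> space M"
  shows "{x} \<in> sets M"
proof -
  obtain T where T: "completely_metrizable_space T" "topspace T = space M"
      "sets M = sigma_sets (space M) {U. openin T U}"
    using assms(1) unfolding standard_borel_def by auto
  have "closedin T {x}"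
    using T(1,2) assms(2) completely_metrizable_imp_metrizable_space metrizable_imp_Hausdorff_space
      Hausdorff_imp_t1_space t1_space_closedin_singleton by metis
  then have "openin T (space M - {x})"
    using T(2) by (simp add: closedin_def)
  then have "space M - {x} \<in> sets M"
    using T(3) by auto
  then have "space M - (space M - {x}) \<in> sets M"
    by (rule sets.compl_sets)
  then show ?thesis
    using assms(2) by (simp add: double_diff)
qed

lemma measurable_iterated:
  assumes K: "K \<in> measurable M (subprob_algebra M)" and "As \<in> lists (sets M)"
  shows "iterated K As \<in> borel_measurable M"
  using assms(2)
proof (induction As)
  case (Cons A As)
  then have [measurable]: "A \<in> sets M" "iterated K As \<in> borel_measurable M" by auto
  have "(\<lambda>x. \<integral>\<^sup>+y. iterated K As y * indicator A y \<partial>K x) \<in> borel_measurable M"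
    by (rule measurable_compose[OF K nn_integral_measurable_subprob_algebra]) measurable
  then show ?case by (simp cong: measurable_cong)
qed simp

lemma measurable_coord:
  "i \<in> I \<Longrightarrow> (\<lambda>\<omega>. \<omega> i) \<in> Pi\<^sub>M I (\<lambda>_. M) \<rightarrow>\<^sub>M M"
  by (rule measurable_component_singleton)

lemma sets_cylinder:
  assumes "As \<in> lists (sets M)"
  shows "cylinder M As \<in> sets (path_space M)"
proof -
  have [measurable]: "As ! i \<in> sets M" if "i < length As" for i
    using assms that by (auto simp: in_lists_conv_set)
  have "cylinder M As = space (path_space M) \<inter>
      (\<Inter>i\<in>{..<length As}. (\<lambda>\<omega>. \<omega> (Suc i)) -` (As ! i) \<inter> space (path_space M))"
    if "As \<noteq> []"
    using that by (auto simp: cylinder_def X_def)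
  moreover have "\<dots> \<in> sets (path_space M)" if "As \<noteq> []"
    using that by (intro sets.Int sets.finite_INT measurable_sets[OF measurable_coord]) auto
  moreover have "cylinder M [] = space (path_space M)"
    by (auto simp: cylinder_def)
  ultimately show ?thesis by (cases "As = []") auto
qed

lemma sets_paths_from:
  assumes "{x} \<in> sets M" shows "paths_from M x \<in> sets (path_space M)"
proof -
  have "paths_from M x = (\<lambda>\<omega>. \<omega> 0) -` {x} \<inter> space (path_space M)"
    by (auto simp: paths_from_def X_def)
  then show ?thesis
    using measurable_sets[OF measurable_coord assms, of 0 UNIV] by simp
qed

lemma is_path_measure_exists:
  assumes K: "K \<in> measurable M (subprob_algebra M)"
    and prob: "\<And>x. x \<in> space M \<Longrightarrow> prob_space (K x)"
    and x: "x \<in> space M" "{x} \<in> sets M"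
  shows "\<exists>Q. is_path_measure M K x Q"
proof -
  define P where "P = (\<lambda>n (\<omega> :: nat \<Rightarrow> 'a). case n of 0 \<Rightarrow> return M x | Suc k \<Rightarrow> K (\<omega> k))"
  have "Ionescu_Tulcea P (\<lambda>_. M)"
  proof (rule Ionescu_Tulcea.intro)
    fix i :: nat
    show "P i \<in> Pi\<^sub>M {0..<i} (\<lambda>_. M) \<rightarrow>\<^sub>M subprob_algebra M"
    proof (cases i)
      case 0
      have "return M x \<in> space (subprob_algebra M)"
        using x by (simp add: space_subprob_algebra subprob_space_return)
      then show ?thesis using 0 by (simp add: P_def)
    next
      case (Suc k)
      then show ?thesis
        by (simp add: P_def)
           (rule measurable_compose[OF measurable_coord K], simp)
    qed
  next
    fix i :: nat and \<omega> :: "nat \<Rightarrow> 'a" assume \<omega>: "\<omega> \<in> space (Pi\<^sub>M {0..<i} (\<lambda>_. M))"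
    show "prob_space (P i \<omega>)"
    proof (cases i)
      case 0 then show ?thesis using x by (simp add: P_def prob_space_return)
    next
      case (Suc k)
      then have "\<omega> k \<in> space M" using \<omega> by (auto simp: space_PiM PiE_iff)
      then show ?thesis using Suc prob by (simp add: P_def)
    qed
  qed
  then interpret IT: Ionescu_Tulcea P "\<lambda>_. M" .
  have sL: "sets IT.PF.lim = sets (path_space M)" by simp
  define D where "D = (\<lambda>n As. {\<omega> \<in> space (Pi\<^sub>M {0..<n + length As} (\<lambda>_. M)).
      \<forall>i<length As. \<omega> (n + i) \<in> As ! i})"
  have D_meas[measurable]: "D n As \<in> sets (Pi\<^sub>M {0..<n + length As} (\<lambda>_. M))"
    if "As \<in> lists (sets M)" for n As
  proof -
    have *: "As ! i \<in> sets M" if "i < length As" for i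
      using \<open>As \<in> lists (sets M)\<close> that by (auto simp: in_lists_conv_set)
    let ?S = "Pi\<^sub>M {0..<n + length As} (\<lambda>_. M)"
    have "D n As = space ?S \<inter> (\<Inter>i\<in>{..<length As}. (\<lambda>\<omega>. \<omega> (n + i)) -` (As ! i) \<inter> space ?S)"
      if "As \<noteq> []"
      using that by (auto simp: D_def)
    moreover have "\<dots> \<in> sets ?S" if "As \<noteq> []"
      using that * by (intro sets.Int sets.finite_INT measurable_sets[OF measurable_coord]) auto
    moreover have "D n [] = space (Pi\<^sub>M {0..<n} (\<lambda>_. M))" by (auto simp: D_def)
    ultimately show ?thesis by (cases "As = []") auto
  qed
  have C: "emeasure (IT.C (Suc n) (length As) \<omega>) (D (Suc n) As) = iterated K As (\<omega> n)"
    if "As \<in> lists (sets M)" "\<omega> \<in> space (Pi\<^sub>M {0..<Suc n} (\<lambda>_. M))" for As n \<omega>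
    using that
  proof (induction As arbitrary: n \<omega> rule: list.induct)
    case Nil
    then show ?case
      using prob_space.emeasure_space_1[OF IT.prob_space_C[of \<omega> "Suc n" 0]]
      by (simp add: D_def)
  next
    case (Cons A As)
    let ?S = "Pi\<^sub>M {0..<Suc n} (\<lambda>_. M)" and ?S' = "Pi\<^sub>M {0..<Suc (Suc n)} (\<lambda>_. M)"
      and ?T = "Pi\<^sub>M {0..<Suc (Suc n) + length As} (\<lambda>_. M)"
    have A: "A \<in> sets M" and As: "As \<in> lists (sets M)" using Cons.prems by auto
    have \<omega>: "\<omega> \<in> space ?S" by fact
    have C1: "IT.C (Suc n) 1 \<omega> = IT.eP (Suc n) \<omega>"
      using bind_return[OF IT.measurable_eP[of "Suc n"] \<omega>] by simp
    have D': "D (Suc n) (A # As) \<in> sets ?T"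
      using D_meas[OF Cons.prems(1), of "Suc n"] by simp
    have mC: "IT.C (Suc (Suc n)) (length As) \<in> ?S' \<rightarrow>\<^sub>M subprob_algebra ?T"
      using IT.measurable_C[of "Suc (Suc n)" "length As"] by simp
    have mC': "(\<lambda>\<omega>'. emeasure (IT.C (Suc (Suc n)) (length As) \<omega>') (D (Suc n) (A # As)))
        \<in> borel_measurable ?S'"
      by (rule measurable_compose[OF mC measurable_emeasure_subprob_algebra[OF D']])
    have upd: "fun_upd \<omega> (Suc n) y \<in> space ?S'" if "y \<in> space M" for y
      using \<omega> that by (auto simp: space_PiM PiE_iff extensional_def)
    have last_eq: "emeasure (IT.C (Suc (Suc n)) (length As) \<omega>') (D (Suc n) (A # As))
        = iterated K As (\<omega>' (Suc n)) * indicator A (\<omega>' (Suc n))"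
      if \<omega>': "\<omega>' \<in> space ?S'" for \<omega>'
    proof -
      interpret C: prob_space "IT.C (Suc (Suc n)) (length As) \<omega>'"
        by (rule IT.prob_space_C[OF \<omega>'])
      have sC: "sets (IT.C (Suc (Suc n)) (length As) \<omega>') = sets ?T"
        using IT.sets_C[OF \<omega>'] by simp
      have spC: "space (IT.C (Suc (Suc n)) (length As) \<omega>') = space ?T"
        using IT.space_C[OF \<omega>'] by simp
      have keep: "AE \<eta> in IT.C (Suc (Suc n)) (length As) \<omega>'. (\<eta> (Suc n) \<in> A) = (\<omega>' (Suc n) \<in> A)"
      proof -
        define H where "H = {\<eta> \<in> space ?S'. (\<eta> (Suc n) \<in> A) = (\<omega>' (Suc n) \<in> A)}"
        have mH: "H \<in> sets ?S'"
        proof (cases "\<omega>' (Suc n) \<in> A")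
          case True
          then have "H = (\<lambda>\<eta>. \<eta> (Suc n)) -` A \<inter> space ?S'" by (auto simp: H_def)
          then show ?thesis
            using measurable_sets[OF measurable_coord A, of "Suc n" "{0..<Suc (Suc n)}"]
            by simp
        next
          case False
          then have "H = space ?S' - ((\<lambda>\<eta>. \<eta> (Suc n)) -` A \<inter> space ?S')" by (auto simp: H_def)
          then show ?thesis
            using measurable_sets[OF measurable_coord A, of "Suc n" "{0..<Suc (Suc n)}"]
            by simp
        qed
        have "emeasure (IT.C (Suc (Suc n)) (length As) \<omega>')
            (prod_emb {0..<Suc (Suc n) + length As} (\<lambda>_. M) {0..<Suc (Suc n) + 0} H)
            = emeasure (IT.C (Suc (Suc n)) 0 \<omega>') H"
          by (rule IT.emeasure_C) (use mH \<omega>' in auto)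
        also have "\<dots> = 1"
          using mH \<omega>' by (simp add: H_def)
        finally have "emeasure (IT.C (Suc (Suc n)) (length As) \<omega>')
            (prod_emb {0..<Suc (Suc n) + length As} (\<lambda>_. M) {0..<Suc (Suc n) + 0} H) = 1" .
        then have "AE \<eta> in IT.C (Suc (Suc n)) (length As) \<omega>'.
            \<eta> \<in> prod_emb {0..<Suc (Suc n) + length As} (\<lambda>_. M) {0..<Suc (Suc n) + 0} H"
          by (intro C.AE_prob_1) (simp add: measure_def)
        then show ?thesis
          by eventually_elim (auto simp: prod_emb_def H_def)
      qed
      show ?thesis
      proof (cases "\<omega>' (Suc n) \<in> A")
        case True
        have "emeasure (IT.C (Suc (Suc n)) (length As) \<omega>') (D (Suc n) (A # As))
            = emeasure (IT.C (Suc (Suc n)) (length As) \<omega>') (D (Suc (Suc n)) As)"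
        proof (rule emeasure_eq_AE)
          show "AE \<eta> in IT.C (Suc (Suc n)) (length As) \<omega>'.
              (\<eta> \<in> D (Suc n) (A # As)) = (\<eta> \<in> D (Suc (Suc n)) As)"
            using keep
            by eventually_elim (use True in \<open>auto simp: D_def nth_Cons less_Suc_eq_0_disj all_conj_distrib split: nat.splits\<close>)
        qed (use D' D_meas[OF As, of "Suc (Suc n)"] sC in auto)
        then show ?thesis
          using Cons.IH[OF As \<omega>'] True by simp
      next
        case False
        have "emeasure (IT.C (Suc (Suc n)) (length As) \<omega>') (D (Suc n) (A # As))
            = emeasure (IT.C (Suc (Suc n)) (length As) \<omega>') {}"
        proof (rule emeasure_eq_AE)
          show "AE \<eta> in IT.C (Suc (Suc n)) (length As) \<omega>'. (\<eta> \<in> D (Suc n) (A # As)) = (\<eta> \<in> {})"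
            using keep by eventually_elim (use False in \<open>auto simp: D_def\<close>)
        qed (use D' sC in auto)
        then show ?thesis using False by simp
      qed
    qed
    have "emeasure (IT.C (Suc n) (length (A # As)) \<omega>) (D (Suc n) (A # As))
        = emeasure (IT.C (Suc n) 1 \<omega> \<bind> IT.C (Suc (Suc n)) (length As)) (D (Suc n) (A # As))"
      using IT.split_C[OF \<omega>, of 1 "length As"] by simp
    also have "\<dots> = (\<integral>\<^sup>+\<omega>'. emeasure (IT.C (Suc (Suc n)) (length As) \<omega>') (D (Suc n) (A # As))
        \<partial>IT.eP (Suc n) \<omega>)"
      unfolding C1
    proof (rule emeasure_bind[OF _ _ D'])
      show "space (IT.eP (Suc n) \<omega>) \<noteq> {}"
        by (rule prob_space.not_empty[OF IT.prob_space_eP[OF \<omega>]])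
      show "IT.C (Suc (Suc n)) (length As) \<in> IT.eP (Suc n) \<omega> \<rightarrow>\<^sub>M subprob_algebra ?T"
        using mC by (simp add: measurable_cong_sets[OF IT.sets_eP[OF \<omega>] refl])
    qed
    also have "\<dots> = (\<integral>\<^sup>+y. emeasure (IT.C (Suc (Suc n)) (length As) (fun_upd \<omega> (Suc n) y))
        (D (Suc n) (A # As)) \<partial>P (Suc n) \<omega>)"
      by (rule IT.nn_integral_eP[OF \<omega> mC'])
    also have "\<dots> = (\<integral>\<^sup>+y. iterated K As y * indicator A y \<partial>P (Suc n) \<omega>)"
      by (intro nn_integral_cong) (simp add: last_eq upd IT.space_P[OF \<omega>])
    also have "\<dots> = iterated K (A # As) (\<omega> n)"
      by (simp add: P_def)
    finally show ?case .
  qed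
  have C0: "emeasure (IT.C 0 (Suc (length As)) (\<lambda>_. undefined))
        {\<omega> \<in> space (Pi\<^sub>M {0..<Suc (length As)} (\<lambda>_. M)). \<omega> 0 \<in> B \<and> (\<forall>i<length As. \<omega> (Suc i) \<in> As ! i)}
      = iterated K As x * indicator B x"
    if As: "As \<in> lists (sets M)" and B: "B \<in> sets M" "B = {x} \<or> B = space M" for As B
  proof -
    let ?u = "\<lambda>_ :: nat. undefined :: 'a" and ?T = "Pi\<^sub>M {0..<1 + length As} (\<lambda>_. M)"
    let ?D = "{\<omega> \<in> space ?T. \<omega> 0 \<in> B \<and> (\<forall>i<length As. \<omega> (Suc i) \<in> As ! i)}"
    have u: "?u \<in> space (Pi\<^sub>M {0..<0} (\<lambda>_. M))" by simp
    have C1: "IT.C 0 1 ?u = IT.eP 0 ?u"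
      using bind_return[OF IT.measurable_eP[of 0] u] by simp
    have Deq: "?D = D 0 (B # As)"
      by (auto simp: D_def nth_Cons less_Suc_eq_0_disj split: nat.splits)
    have D': "?D \<in> sets ?T"
      unfolding Deq using D_meas[of "B # As" 0] As B by simp
    have mC: "IT.C (Suc 0) (length As) \<in> Pi\<^sub>M {0..<Suc 0} (\<lambda>_. M) \<rightarrow>\<^sub>M subprob_algebra ?T"
      using IT.measurable_C[of "Suc 0" "length As"] by simp
    have mC': "(\<lambda>\<omega>'. emeasure (IT.C (Suc 0) (length As) \<omega>') ?D)
        \<in> borel_measurable (Pi\<^sub>M {0..<Suc 0} (\<lambda>_. M))"
      by (rule measurable_compose[OF mC measurable_emeasure_subprob_algebra[OF D']])
    have "emeasure (IT.C 0 (1 + length As) ?u) ?D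
        = emeasure (IT.C 0 1 ?u \<bind> IT.C (0 + 1) (length As)) ?D"
      using IT.split_C[OF u, of 1 "length As"] by simp
    also have "\<dots> = (\<integral>\<^sup>+\<omega>'. emeasure (IT.C (Suc 0) (length As) \<omega>') ?D \<partial>IT.eP 0 ?u)"
      unfolding C1 add_0_left One_nat_def[symmetric]
    proof (rule emeasure_bind[OF _ _ D'])
      show "space (IT.eP 0 ?u) \<noteq> {}"
        by (rule prob_space.not_empty[OF IT.prob_space_eP[OF u]])
      show "IT.C 1 (length As) \<in> IT.eP 0 ?u \<rightarrow>\<^sub>M subprob_algebra ?T"
        using mC by (simp add: measurable_cong_sets[OF IT.sets_eP[OF u] refl])
    qed
    also have "\<dots> = (\<integral>\<^sup>+y. emeasure (IT.C (Suc 0) (length As) (fun_upd ?u 0 y)) ?D \<partial>P 0 ?u)"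
      by (rule IT.nn_integral_eP[OF u mC'])
    also have "\<dots> = (\<integral>\<^sup>+y. emeasure (IT.C (Suc 0) (length As) (fun_upd ?u 0 y)) ?D \<partial>return M x)"
      by (simp add: P_def)
    also have "\<dots> = emeasure (IT.C (Suc 0) (length As) (fun_upd ?u 0 x)) ?D"
    proof (rule nn_integral_return[OF x(1)])
      have "(\<lambda>y. fun_upd ?u 0 y) \<in> M \<rightarrow>\<^sub>M Pi\<^sub>M {0..<Suc 0} (\<lambda>_. M)"
        by (rule measurable_fun_upd[where J="{}"]) (auto simp: space_PiM)
      from measurable_compose[OF this mC']
      show "(\<lambda>y. emeasure (IT.C (Suc 0) (length As) (fun_upd ?u 0 y)) ?D) \<in> borel_measurable M" .
    qed
    also have "\<dots> = emeasure (IT.C (Suc 0) (length As) (fun_upd ?u 0 x)) (D (Suc 0) As)"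
    proof -
      have ux: "fun_upd ?u 0 x \<in> space (Pi\<^sub>M {0..<Suc 0} (\<lambda>_. M))"
        using x by (auto simp: space_PiM PiE_iff extensional_def)
      interpret C: prob_space "IT.C (Suc 0) (length As) (fun_upd ?u 0 x)"
        by (rule IT.prob_space_C[OF ux])
      have sC: "sets (IT.C (Suc 0) (length As) (fun_upd ?u 0 x)) = sets ?T"
        using IT.sets_C[OF ux] by simp
      define H where "H = {\<eta> \<in> space (Pi\<^sub>M {0..<Suc 0} (\<lambda>_. M)). \<eta> 0 \<in> B}"
      have mH: "H \<in> sets (Pi\<^sub>M {0..<Suc 0} (\<lambda>_. M))"
      proof -
        have "H = (\<lambda>\<eta>. \<eta> 0) -` B \<inter> space (Pi\<^sub>M {0..<Suc 0} (\<lambda>_. M))" by (auto simp: H_def)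
        then show ?thesis
          using measurable_sets[OF measurable_coord B(1), of 0 "{0..<Suc 0}"] by simp
      qed
      have "emeasure (IT.C (Suc 0) (length As) (fun_upd ?u 0 x))
          (prod_emb {0..<Suc 0 + length As} (\<lambda>_. M) {0..<Suc 0 + 0} H)
          = emeasure (IT.C (Suc 0) 0 (fun_upd ?u 0 x)) H"
        by (rule IT.emeasure_C) (use mH ux in auto)
      also have "\<dots> = 1"
        using mH ux B(2) x by (auto simp add: H_def indicator_def)
      finally have "AE \<eta> in IT.C (Suc 0) (length As) (fun_upd ?u 0 x).
          \<eta> \<in> prod_emb {0..<Suc 0 + length As} (\<lambda>_. M) {0..<Suc 0 + 0} H"
        by (intro C.AE_prob_1) (simp add: measure_def)
      then have keep: "AE \<eta> in IT.C (Suc 0) (length As) (fun_upd ?u 0 x). \<eta> 0 \<in> B"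
        by eventually_elim (auto simp: prod_emb_def H_def)
      show ?thesis
      proof (rule emeasure_eq_AE)
        show "AE \<eta> in IT.C (Suc 0) (length As) (fun_upd ?u 0 x). (\<eta> \<in> ?D) = (\<eta> \<in> D (Suc 0) As)"
          using keep by eventually_elim (auto simp: D_def)
      qed (use D' D_meas[OF As, of "Suc 0"] sC in auto)
    qed
    also have "\<dots> = iterated K As x"
      using C[OF As, of "fun_upd ?u 0 x" 0] x by (simp add: space_PiM PiE_iff extensional_def)
    finally show ?thesis using B x by auto
  qed
  have lim: "emeasure IT.PF.lim
        {\<omega> \<in> space (path_space M). \<omega> 0 \<in> B \<and> (\<forall>i<length As. \<omega> (Suc i) \<in> As ! i)}
      = iterated K As x * indicator B x"
    if As: "As \<in> lists (sets M)" and B: "B \<in> sets M" "B = {x} \<or> B = space M" for As B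
  proof -
    let ?J = "{0..<Suc (length As)}"
    let ?D = "{\<omega> \<in> space (Pi\<^sub>M ?J (\<lambda>_. M)). \<omega> 0 \<in> B \<and> (\<forall>i<length As. \<omega> (Suc i) \<in> As ! i)}"
    have Deq: "?D = D 0 (B # As)"
      by (auto simp: D_def nth_Cons less_Suc_eq_0_disj split: nat.splits)
    have D': "?D \<in> sets (Pi\<^sub>M ?J (\<lambda>_. M))"
      unfolding Deq using D_meas[of "B # As" 0] As B by simp
    have "{\<omega> \<in> space (path_space M). \<omega> 0 \<in> B \<and> (\<forall>i<length As. \<omega> (Suc i) \<in> As ! i)}
        = prod_emb UNIV (\<lambda>_. M) ?J ?D"
      by (auto simp: prod_emb_def space_PiM)
    then have "emeasure IT.PF.lim
        {\<omega> \<in> space (path_space M). \<omega> 0 \<in> B \<and> (\<forall>i<length As. \<omega> (Suc i) \<in> As ! i)}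
        = emeasure (IT.CI ?J) ?D"
      using IT.lim[OF _ D'] by simp
    also have "\<dots> = emeasure (IT.C 0 (Suc (length As)) (\<lambda>_. undefined)) (prod_emb ?J (\<lambda>_. M) ?J ?D)"
      by (rule IT.emeasure_CI[OF _ D']) simp
    also have "prod_emb ?J (\<lambda>_. M) ?J ?D = ?D"
      by (rule prod_emb_id) (auto simp: space_PiM)
    finally show ?thesis using C0[OF As B] by simp
  qed
  have "is_path_measure M K x IT.PF.lim"
    unfolding is_path_measure_def
  proof (intro conjI ballI)
    have "{\<omega> \<in> space (path_space M). \<omega> 0 \<in> space M \<and> (\<forall>i<length []. \<omega> (Suc i) \<in> [] ! i)}
        = space IT.PF.lim"
      by (auto simp: space_PiM IT.PF.space_lim)
    then have "emeasure IT.PF.lim (space IT.PF.lim) = 1"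
      using lim[of "[]" "space M"] x by (simp del: IT.PF.space_lim)
    then show "prob_space IT.PF.lim" by (rule prob_spaceI)
    show "sets IT.PF.lim = sets (path_space M)" by (rule sL)
    show "emeasure IT.PF.lim (paths_from M x) = 1"
      using lim[of "[]" "{x}"] x by (simp add: paths_from_def X_def)
    fix As assume "As \<in> lists (sets M)"
    moreover have "cylinder M As = {\<omega> \<in> space (path_space M). \<omega> 0 \<in> space M \<and>
        (\<forall>i<length As. \<omega> (Suc i) \<in> As ! i)}"
      by (auto simp: cylinder_def X_def space_PiM)
    ultimately show "emeasure IT.PF.lim (cylinder M As) = iterated K As x"
      using lim[of As "space M"] x by simp
  qed
  then show ?thesis ..
qed

lemma is_path_measure_emb:
  assumes Q: "is_path_measure M K x Q" and x: "{x} \<in> sets M"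
    and J: "finite J" "\<And>i. i \<in> J \<Longrightarrow> A i \<in> sets M"
  shows "emeasure Q (prod_emb UNIV (\<lambda>_. M) J (Pi\<^sub>E J A)) =
    iterated K (map (\<lambda>i. if i \<in> J then A i else space M) [1..<Suc (Max (insert 0 J))]) x *
    indicator (if 0 \<in> J then A 0 else space M) x"
proof -
  define B where "B = (\<lambda>i. if i \<in> J then A i else space M)"
  define N where "N = Max (insert 0 J)"
  define As where "As = map B [1..<Suc N]"
  interpret Q: prob_space Q using Q by (simp add: is_path_measure_def)
  have sQ: "sets Q = sets (path_space M)" using Q by (simp add: is_path_measure_def)
  have B: "B i \<in> sets M" for i using J by (auto simp: B_def)
  have As: "As \<in> lists (sets M)" using B by (auto simp: As_def in_lists_conv_set)
  have len: "length As = N" by (simp add: As_def)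
  have nth: "As ! i = B (Suc i)" if "i < N" for i
    using that by (simp add: As_def nth_append del: upt_Suc)
  have le: "i \<le> N" if "i \<in> J" for i using J that by (simp add: N_def)
  let ?S = "prod_emb UNIV (\<lambda>_. M) J (Pi\<^sub>E J A)"
  have S: "\<omega> \<in> ?S \<longleftrightarrow> \<omega> 0 \<in> B 0 \<and> \<omega> \<in> cylinder M As" if "\<omega> \<in> space (path_space M)" for \<omega>
  proof -
    have sp: "\<omega> i \<in> space M" for i using that by (auto simp: space_PiM)
    have "\<omega> \<in> ?S \<longleftrightarrow> (\<forall>i\<in>J. \<omega> i \<in> A i)"
      using that by (auto simp: prod_emb_def space_PiM)
    also have "\<dots> \<longleftrightarrow> (\<forall>i\<le>N. \<omega> i \<in> B i)"
      using sp le by (auto simp: B_def)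
    also have "\<dots> \<longleftrightarrow> \<omega> 0 \<in> B 0 \<and> (\<forall>i<N. \<omega> (Suc i) \<in> B (Suc i))"
      by (metis Suc_le_eq le0 not0_implies_Suc)
    also have "\<dots> \<longleftrightarrow> \<omega> 0 \<in> B 0 \<and> \<omega> \<in> cylinder M As"
      using that by (auto simp: cylinder_def X_def len nth)
    finally show ?thesis .
  qed
  have mS: "?S \<in> sets Q"
    unfolding sQ using J by (intro measurable_prod_emb sets_PiM_I_finite) auto
  have "AE \<omega> in Q. \<omega> \<in> paths_from M x"
    using Q by (intro Q.AE_prob_1) (simp add: is_path_measure_def measure_def)
  then have ae: "AE \<omega> in Q. \<omega> \<in> space (path_space M) \<and> \<omega> 0 = x"
    by eventually_elim (auto simp: paths_from_def X_def)
  have "emeasure Q ?S = emeasure Q (if x \<in> B 0 then cylinder M As else {})"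
  proof (rule emeasure_eq_AE)
    show "AE \<omega> in Q. (\<omega> \<in> ?S) = (\<omega> \<in> (if x \<in> B 0 then cylinder M As else {}))"
      using ae by eventually_elim (simp add: S)
  qed (use mS sets_cylinder[OF As] sQ in auto)
  also have "\<dots> = iterated K As x * indicator (B 0) x"
    using Q As by (simp add: is_path_measure_def)
  finally show ?thesis by (simp add: As_def B_def N_def)
qed

lemma is_path_measure_unique:
  assumes "is_path_measure M K x Q" "is_path_measure M K x Q'" "{x} \<in> sets M"
  shows "Q = Q'"
proof (rule measure_eqI_PiM_infinite)
  show "sets Q = sets (path_space M)" "sets Q' = sets (path_space M)"
    using assms by (auto simp: is_path_measure_def)
  show "finite_measure Q"
    using assms by (auto simp: is_path_measure_def prob_space_def)
qed (use assms in \<open>simp add: is_path_measure_emb\<close>)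

context symmetric_measure
begin

lemma singleton: "x \<in> space \<mu> \<Longrightarrow> {x} \<in> sets \<mu>"
  using standard standard_borel_singleton by (auto simp: standard_measure_space_def)

lemma c_measurable: "c_fun \<mu> \<kappa> \<in> borel_measurable \<mu>"
  unfolding c_fun_def using measurable_\<kappa>[OF sets.top] by simp

lemma sets_transition: "x \<in> space \<mu> \<Longrightarrow> sets (transition \<mu> \<kappa> x) = sets \<mu>"
  by (simp add: transition_def sets_\<kappa>)

lemma prob_transition:
  assumes "x \<in> space \<mu>" shows "prob_space (transition \<mu> \<kappa> x)"
proof (cases "0 < c_fun \<mu> \<kappa> x \<and> c_fun \<mu> \<kappa> x < \<infinity>")
  case True
  have "space (\<kappa> x) = space \<mu>" using sets_\<kappa>[OF assms] by (rule sets_eq_imp_space_eq)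
  then have "emeasure (transition \<mu> \<kappa> x) (space (transition \<mu> \<kappa> x)) =
      inverse (c_fun \<mu> \<kappa> x) * c_fun \<mu> \<kappa> x"
    using True by (simp add: transition_def space_scale_measure emeasure_scale_measure c_fun_def)
  also have "\<dots> = 1"
    using True ennreal_inverse_mult[of "c_fun \<mu> \<kappa> x"]
    by (metis divide_ennreal_def ennreal_divide_self infinity_ennreal_def less_irrefl mult.commute)
  finally show ?thesis by (rule prob_spaceI)
next
  case False
  then show ?thesis using assms unfolding transition_def by (simp only: if_False prob_space_return)
qed

lemma measurable_transition: "transition \<mu> \<kappa> \<in> \<mu> \<rightarrow>\<^sub>M subprob_algebra \<mu>"
proof (rule measurable_subprob_algebra)
  fix A assume A: "A \<in> sets \<mu>"
  have [measurable]: "c_fun \<mu> \<kappa> \<in> borel_measurable \<mu>" by (rule c_measurable)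
  note measurable_\<kappa>[OF A, measurable] A[measurable]
  have "(\<lambda>x. if 0 < c_fun \<mu> \<kappa> x \<and> c_fun \<mu> \<kappa> x < \<infinity>
      then inverse (c_fun \<mu> \<kappa> x) * emeasure (\<kappa> x) A else indicator A x) \<in> borel_measurable \<mu>"
    by measurable
  moreover have "emeasure (transition \<mu> \<kappa> x) A = (if 0 < c_fun \<mu> \<kappa> x \<and> c_fun \<mu> \<kappa> x < \<infinity>
      then inverse (c_fun \<mu> \<kappa> x) * emeasure (\<kappa> x) A else indicator A x)" for x
    using A unfolding transition_def by (simp only: if_split emeasure_scale_measure emeasure_return) simp
  ultimately show "(\<lambda>x. emeasure (transition \<mu> \<kappa> x) A) \<in> borel_measurable \<mu>"
    by simp
qed (simp_all add: prob_space_imp_subprob_space prob_transition sets_transition)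

lemma path_measure:
  assumes "x \<in> space \<mu>"
  shows "is_path_measure \<mu> (transition \<mu> \<kappa>) x (path_measure \<mu> \<kappa> x)"
  unfolding path_measure_def
proof (rule theI')
  show "\<exists>!Q. is_path_measure \<mu> (transition \<mu> \<kappa>) x Q"
    using is_path_measure_exists[OF measurable_transition prob_transition assms singleton[OF assms]]
      is_path_measure_unique[OF _ _ singleton[OF assms]] by blast
qed

lemma measurable_path_measure: "path_measure \<mu> \<kappa> \<in> \<mu> \<rightarrow>\<^sub>M subprob_algebra (path_space \<mu>)"
proof (rule measurable_subprob_algebra_generated[OF sets_PiM Int_stable_prod_algebra prod_algebra_sets_into_space])
  fix x assume x: "x \<in> space \<mu>"
  show "subprob_space (path_measure \<mu> \<kappa> x)" "sets (path_measure \<mu> \<kappa> x) = sets (path_space \<mu>)"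
    using path_measure[OF x] by (auto simp: is_path_measure_def prob_space_imp_subprob_space)
next
  fix S :: "(nat \<Rightarrow> 'a) set" assume "S \<in> prod_algebra UNIV (\<lambda>_. \<mu>)"
  then obtain J A where S: "S = prod_emb UNIV (\<lambda>_. \<mu>) J (Pi\<^sub>E J A)" and J: "finite J"
      "\<And>i. i \<in> J \<Longrightarrow> A i \<in> sets \<mu>"
    by (rule prod_algebraE) auto
  define As where "As = map (\<lambda>i. if i \<in> J then A i else space \<mu>) [1..<Suc (Max (insert 0 J))]"
  have "As \<in> lists (sets \<mu>)" using J by (auto simp: As_def in_lists_conv_set)
  note measurable_iterated[OF measurable_transition this, measurable]
  have [measurable]: "(if 0 \<in> J then A 0 else space \<mu>) \<in> sets \<mu>" using J by auto
  have "(\<lambda>x. iterated (transition \<mu> \<kappa>) As x * indicator (if 0 \<in> J then A 0 else space \<mu>) x)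
      \<in> borel_measurable \<mu>"
    by measurable
  then show "(\<lambda>x. emeasure (path_measure \<mu> \<kappa> x) S) \<in> borel_measurable \<mu>"
    by (rule measurable_cong[THEN iffD2, rotated])
       (unfold S As_def, rule is_path_measure_emb[OF path_measure singleton J])
next
  have "emeasure (path_measure \<mu> \<kappa> x) (\<Pi>\<^sub>E i\<in>UNIV. space \<mu>) = 1" if "x \<in> space \<mu>" for x
    using path_measure[OF that] prob_space.emeasure_space_1[of "path_measure \<mu> \<kappa> x"]
      sets_eq_imp_space_eq[of "path_measure \<mu> \<kappa> x" "path_space \<mu>"]
    by (simp add: is_path_measure_def space_PiM)
  then show "(\<lambda>x. emeasure (path_measure \<mu> \<kappa> x) (\<Pi>\<^sub>E i\<in>UNIV. space \<mu>)) \<in> borel_measurable \<mu>"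
    by (simp cong: measurable_cong)
qed

lemma sets_nu_measure: "sets (nu_measure \<mu> \<kappa>) = sets \<mu>"
  by (simp add: nu_measure_def)

lemma space_nonempty: "space \<mu> \<noteq> {}"
  using infinite by auto

lemma sets_path_lambda: "sets (path_lambda \<mu> \<kappa>) = sets (path_space \<mu>)"
  unfolding path_lambda_def
  by (rule sets_bind)
     (use path_measure space_nonempty in \<open>auto simp: nu_measure_def is_path_measure_def\<close>)

lemma emeasure_path_lambda:
  assumes "A \<in> sets (path_space \<mu>)"
  shows "emeasure (path_lambda \<mu> \<kappa>) A = (\<integral>\<^sup>+x. emeasure (path_measure \<mu> \<kappa> x) A \<partial>nu_measure \<mu> \<kappa>)"
  unfolding path_lambda_def
  by (rule emeasure_bind[OF _ _ assms])
     (use space_nonempty measurable_path_measure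
       in \<open>auto simp: nu_measure_def measurable_cong_sets[OF sets_nu_measure refl, unfolded nu_measure_def]\<close>)

end

end

theory Submission
  imports Defs
begin

text \<open>
  Two facts about the Markov chain carry the proof.

  The Markov property: under \<open>\<bbbP>\<^sub>x\<close>, given \<open>X\<^sub>n\<close> the law of \<open>X\<^bsub>n+1\<^esub>\<close> is \<open>P(X\<^sub>n, \<cdot>)\<close>.  Hence
  \<open>P f \<circ> X\<^sub>n\<close> is the conditional expectation of \<open>f \<circ> X\<^bsub>n+1\<^esub>\<close>, and the difference of the two is
  orthogonal to every square integrable function of \<open>X\<^sub>n\<close>, in particular to \<open>(I - P) f \<circ> X\<^sub>n\<close>.  The orthogonality
  thus holds under each single \<open>\<bbbP>\<^sub>x\<close>, before integrating over the starting point.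

  The invariance of \<open>\<nu>\<close>: since \<open>\<nu>(dx) P(x, dy) = \<rho>(dx, dy)\<close> is symmetric, \<open>\<nu> P = \<nu>\<close>, so each \<open>X\<^sub>n\<close>
  has law \<open>\<nu>\<close> under \<open>\<lambda>\<close>.  Composition with \<open>X\<^sub>n\<close> is therefore an isometry of \<open>L\<^sup>2(\<nu>)\<close> into
  \<open>L\<^sup>2(\<lambda>)\<close>; as \<open>P\<close> is a contraction of \<open>L\<^sup>2(\<nu>)\<close> by Jensen's inequality, both functions belong to
  the dissipation space.

  Both facts follow by induction on \<open>n\<close> from the first-step decomposition: a path from \<open>x\<close> is
  \<open>x\<close> followed by a path whose starting point is drawn from \<open>P(x, \<cdot>)\<close>.  This decomposition is
  read off from the uniqueness of the path measures.
\<close>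

section \<open>Square integrable functions and kernels\<close>

lemma L2_diff:
  assumes "f \<in> L2 M" "g \<in> L2 M"
  shows "(\<lambda>x. f x - g x) \<in> L2 M"
proof -
  have [measurable]: "f \<in> borel_measurable M" "g \<in> borel_measurable M"
    and int: "integrable M (\<lambda>x. (f x)\<^sup>2)" "integrable M (\<lambda>x. (g x)\<^sup>2)"
    using assms by (auto simp: L2_def)
  have "integrable M (\<lambda>x. (f x - g x)\<^sup>2)"
  proof (rule Bochner_Integration.integrable_bound)
    show "integrable M (\<lambda>x. 2 * (f x)\<^sup>2 + 2 * (g x)\<^sup>2)"
      using int by simp
    have "(a - b)\<^sup>2 \<le> 2 * a\<^sup>2 + 2 * b\<^sup>2" for a b :: real
      using zero_le_power2[of "a + b"] by (simp add: power2_diff power2_sum)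
    then show "AE x in M. norm ((f x - g x)\<^sup>2) \<le> norm (2 * (f x)\<^sup>2 + 2 * (g x)\<^sup>2)"
      by (intro AE_I2) (auto intro: order_trans[OF _ abs_ge_self])
  qed measurable
  then show ?thesis by (simp add: L2_def)
qed

lemma L2_iff_nn_integral:
  "f \<in> L2 M \<longleftrightarrow> f \<in> borel_measurable M \<and> (\<integral>\<^sup>+x. ennreal ((f x)\<^sup>2) \<partial>M) < \<infinity>"
  unfolding L2_def by (auto simp: integrable_iff_bounded)

text \<open>
  If \<open>f\<close> is not square integrable, the right-hand side is infinite; otherwise \<open>f\<close> is integrable
  and this is the nonnegativity of its variance.
\<close>

lemma (in prob_space) square_integral_le_nn_integral_square:
  assumes [measurable]: "f \<in> borel_measurable M"
  shows "ennreal ((\<integral>x. f x \<partial>M)\<^sup>2) \<le> (\<integral>\<^sup>+x. ennreal ((f x)\<^sup>2) \<partial>M)"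
proof (cases "(\<integral>\<^sup>+x. ennreal ((f x)\<^sup>2) \<partial>M) < \<infinity>")
  case True
  then have int2: "integrable M (\<lambda>x. (f x)\<^sup>2)"
    by (simp add: integrable_iff_bounded)
  then have "integrable M f"
    by (rule square_integrable_imp_integrable[rotated]) measurable
  then have "(\<integral>x. f x \<partial>M)\<^sup>2 \<le> (\<integral>x. (f x)\<^sup>2 \<partial>M)"
    using variance_eq[OF _ int2] variance_positive[of f] by simp
  then show ?thesis
    using int2 by (simp add: nn_integral_eq_integral ennreal_leI)
next
  case False
  then show ?thesis by (simp add: less_top[symmetric])
qed

text \<open>
  Positive and negative part of \<open>h\<close> have the same integral against almost every \<open>N x\<close>, hence
  against the mixture.  When \<open>h\<close> is not integrable for the mixture, its Bochner integral is \<open>0\<close>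
  by convention.
\<close>

lemma integral_bind_eq_0:
  fixes h :: "'b \<Rightarrow> real"
  assumes N: "N \<in> M \<rightarrow>\<^sub>M subprob_algebra B" and h[measurable]: "h \<in> borel_measurable B"
    and zero: "\<And>x. x \<in> space M \<Longrightarrow> (\<integral>y. h y \<partial>N x) = 0"
  shows "(\<integral>y. h y \<partial>(M \<bind> N)) = 0"
proof (cases "integrable (M \<bind> N) h \<and> space M \<noteq> {}")
  case True
  let ?pos = "\<lambda>y. ennreal (h y)" and ?neg = "\<lambda>y. ennreal (- h y)"
  have sN: "sets (N x) = sets B" if "x \<in> space M" for x
    using N that by (rule sets_kernel)
  have bind: "(\<integral>\<^sup>+y. u y \<partial>(M \<bind> N)) = (\<integral>\<^sup>+x. (\<integral>\<^sup>+y. u y \<partial>N x) \<partial>M)"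
    if "u \<in> borel_measurable B" for u
    using that N by (rule nn_integral_bind)
  have meas: "(\<lambda>x. \<integral>\<^sup>+y. u y \<partial>N x) \<in> borel_measurable M" if "u \<in> borel_measurable B" for u
    using measurable_compose[OF N nn_integral_measurable_subprob_algebra[OF that]] .
  have fin: "(\<integral>\<^sup>+y. ?pos y \<partial>(M \<bind> N)) \<noteq> \<infinity>" "(\<integral>\<^sup>+y. ?neg y \<partial>(M \<bind> N)) \<noteq> \<infinity>"
    using True by (auto simp: real_integrable_def)
  have "AE x in M. (\<integral>\<^sup>+y. ?pos y \<partial>N x) \<noteq> \<infinity>"
    using fin(1) by (intro nn_integral_PInf_AE meas) (simp_all add: bind)
  moreover have "AE x in M. (\<integral>\<^sup>+y. ?neg y \<partial>N x) \<noteq> \<infinity>"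
    using fin(2) by (intro nn_integral_PInf_AE meas) (simp_all add: bind)
  ultimately have "AE x in M. (\<integral>\<^sup>+y. ?pos y \<partial>N x) = (\<integral>\<^sup>+y. ?neg y \<partial>N x)"
    using AE_space
  proof eventually_elim
    case (elim x)
    have "h \<in> borel_measurable (N x)"
      unfolding measurable_cong_sets[OF sN[OF elim(3)] refl] by (rule h)
    then have "integrable (N x) h"
      using elim by (simp add: real_integrable_def)
    then have "enn2real (\<integral>\<^sup>+y. ?pos y \<partial>N x) = enn2real (\<integral>\<^sup>+y. ?neg y \<partial>N x)"
      using zero[OF elim(3)] by (simp add: real_lebesgue_integral_def)
    then show ?case
      using elim by (metis ennreal_enn2real infinity_ennreal_def top.not_eq_extremum)
  qed
  then have "(\<integral>\<^sup>+y. ?pos y \<partial>(M \<bind> N)) = (\<integral>\<^sup>+y. ?neg y \<partial>(M \<bind> N))"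
    by (simp add: bind nn_integral_cong_AE)
  then show ?thesis
    using True by (simp add: real_lebesgue_integral_def)
next
  case False
  then show ?thesis
    by (auto simp: not_integrable_integral_eq bind_empty
      Bochner_Integration.integral_empty)
qed


section \<open>First step decomposition and the Markov property\<close>

lemma measurable_case_nat_path:
  assumes "x \<in> space M"
  shows "case_nat x \<in> path_space M \<rightarrow>\<^sub>M path_space M"
proof (rule measurable_PiM_single')
  fix i :: nat
  show "(\<lambda>\<omega>. case_nat x \<omega> i) \<in> path_space M \<rightarrow>\<^sub>M M"
    using assms by (cases i) (simp_all add: measurable_coord)
qed (use assms in \<open>auto simp: space_PiM PiE_iff split: nat.split\<close>)

lemma measurable_X: "X n \<in> path_space M \<rightarrow>\<^sub>M M"
  unfolding X_def[abs_def] by (rule measurable_coord) simp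

lemma X_case_nat: "X 0 (case_nat x \<omega>) = x" "X (Suc n) (case_nat x \<omega>) = X n \<omega>"
  by (simp_all add: X_def)

locale path_kernel =
  fixes M :: "'a measure" and K :: "'a \<Rightarrow> 'a measure" and Q :: "'a \<Rightarrow> (nat \<Rightarrow> 'a) measure"
  assumes K: "K \<in> M \<rightarrow>\<^sub>M subprob_algebra M"
    and prob_K: "\<And>x. x \<in> space M \<Longrightarrow> prob_space (K x)"
    and Q: "Q \<in> M \<rightarrow>\<^sub>M subprob_algebra (path_space M)"
    and singletons: "\<And>x. x \<in> space M \<Longrightarrow> {x} \<in> sets M"
    and path: "\<And>x. x \<in> space M \<Longrightarrow> is_path_measure M K x (Q x)"
begin

lemma sets_K: "x \<in> space M \<Longrightarrow> sets (K x) = sets M"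
  using K by (rule sets_kernel)

lemma space_K: "x \<in> space M \<Longrightarrow> space (K x) = space M"
  by (intro sets_eq_imp_space_eq sets_K)

lemma sets_Q: "x \<in> space M \<Longrightarrow> sets (Q x) = sets (path_space M)"
  using Q by (rule sets_kernel)

lemma space_Q: "x \<in> space M \<Longrightarrow> space (Q x) = space (path_space M)"
  by (intro sets_eq_imp_space_eq sets_Q)

lemma prob_Q: "x \<in> space M \<Longrightarrow> prob_space (Q x)"
  using path by (auto simp: is_path_measure_def)

lemma Q_K: "x \<in> space M \<Longrightarrow> Q \<in> K x \<rightarrow>\<^sub>M subprob_algebra (path_space M)"
  using Q measurable_cong_sets[OF sets_K refl] by blast

lemma measurable_nn_integral_Q:
  "u \<in> borel_measurable (path_space M) \<Longrightarrow> (\<lambda>x. \<integral>\<^sup>+\<omega>. u \<omega> \<partial>Q x) \<in> borel_measurable M"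
  using measurable_compose[OF Q nn_integral_measurable_subprob_algebra] .

lemma AE_paths_from:
  assumes "x \<in> space M" shows "AE \<omega> in Q x. \<omega> \<in> paths_from M x"
proof -
  interpret Qx: prob_space "Q x" using assms by (rule prob_Q)
  show ?thesis
    using path[OF assms] by (intro Qx.AE_prob_1) (simp add: is_path_measure_def measure_def)
qed

lemma AE_start: "x \<in> space M \<Longrightarrow> AE \<omega> in Q x. X 0 \<omega> = x"
  by (drule AE_paths_from, erule eventually_mono, simp add: paths_from_def)

text \<open>
  Prepending \<open>x\<close> to a path whose starting point has law \<open>K x\<close> gives a measure with the cylinder
  values that characterise \<open>Q x\<close>.
\<close>

lemma first_step:
  assumes x: "x \<in> space M"
  shows "Q x = distr (K x \<bind> Q) (path_space M) (case_nat x)" (is "_ = ?R")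
proof (rule is_path_measure_unique[OF path[OF x] _ singletons[OF x]])
  interpret Kx: prob_space "K x" using x by (rule prob_K)
  have ne: "space (K x) \<noteq> {}" by (rule Kx.not_empty)
  have sB: "sets (K x \<bind> Q) = sets (path_space M)"
    using sets_Q space_K[OF x] ne by (intro sets_bind) auto
  then have mB: "case_nat x \<in> (K x \<bind> Q) \<rightarrow>\<^sub>M path_space M"
    using measurable_case_nat_path[OF x] measurable_cong_sets by blast
  have spB: "space (K x \<bind> Q) = space (path_space M)"
    using sB by (rule sets_eq_imp_space_eq)
  have emeasure_R: "emeasure ?R S =
      (\<integral>\<^sup>+y. emeasure (Q y) (case_nat x -` S \<inter> space (path_space M)) \<partial>K x)"
    if S: "S \<in> sets (path_space M)" for S
    using S mB spB emeasure_bind[OF ne Q_K[OF x]]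
      measurable_sets[OF measurable_case_nat_path[OF x] S]
    by (simp add: emeasure_distr)
  have prob_R: "prob_space ?R"
  proof (rule prob_space.prob_space_distr[OF _ mB], rule Kx.prob_space_bind[OF _ Q_K[OF x]])
    show "AE y in K x. prob_space (Q y)"
      using prob_Q space_K[OF x] by (intro AE_I2) simp
  qed
  interpret R: prob_space ?R by (rule prob_R)
  have all: "case_nat x \<omega> \<in> space (path_space M)" if "\<omega> \<in> space (path_space M)" for \<omega>
    using measurable_space[OF measurable_case_nat_path[OF x] that] .
  show "is_path_measure M K x ?R"
    unfolding is_path_measure_def
  proof (intro conjI ballI)
    show "prob_space ?R" by (rule prob_R)
    show "sets ?R = sets (path_space M)" by simp
    have "case_nat x -` paths_from M x \<inter> space (path_space M) = space (path_space M)"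
      using all by (auto simp: paths_from_def X_case_nat)
    then have "emeasure ?R (paths_from M x) = (\<integral>\<^sup>+y. emeasure (Q y) (space (path_space M)) \<partial>K x)"
      by (simp add: emeasure_R sets_paths_from[OF singletons[OF x]])
    also have "\<dots> = (\<integral>\<^sup>+y. 1 \<partial>K x)"
      using prob_space.emeasure_space_1[OF prob_Q] space_Q space_K[OF x]
      by (intro nn_integral_cong) metis
    finally show "emeasure ?R (paths_from M x) = 1"
      by (simp add: Kx.emeasure_space_1)
  next
    fix As assume As: "As \<in> lists (sets M)"
    show "emeasure ?R (cylinder M As) = iterated K As x"
    proof (cases As)
      case Nil
      then have "cylinder M As = space ?R" by (simp add: cylinder_def)
      then show ?thesis using Nil R.emeasure_space_1 by simp
    next
      case (Cons A Bs)
      then have A: "A \<in> sets M" and Bs: "Bs \<in> lists (sets M)" using As by auto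
      have pre: "case_nat x -` cylinder M As \<inter> space (path_space M)
          = {\<omega> \<in> space (path_space M). X 0 \<omega> \<in> A \<and> \<omega> \<in> cylinder M Bs}"
        using all by (auto simp: cylinder_def Cons X_case_nat nth_Cons less_Suc_eq_0_disj
          split: nat.splits)
      have "emeasure (Q y) (case_nat x -` cylinder M As \<inter> space (path_space M))
          = iterated K Bs y * indicator A y" if "y \<in> space M" for y
      proof -
        have "emeasure (Q y) (case_nat x -` cylinder M As \<inter> space (path_space M))
            = emeasure (Q y) (if y \<in> A then cylinder M Bs else {})"
        proof (rule emeasure_eq_AE)
          show "AE \<omega> in Q y. (\<omega> \<in> case_nat x -` cylinder M As \<inter> space (path_space M))
              = (\<omega> \<in> (if y \<in> A then cylinder M Bs else {}))"
            unfolding pre using AE_start[OF that] AE_space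
            by eventually_elim (auto simp: space_Q[OF that])
          show "case_nat x -` cylinder M As \<inter> space (path_space M) \<in> sets (Q y)"
            unfolding sets_Q[OF that]
            using measurable_case_nat_path[OF x] sets_cylinder[OF As] by (rule measurable_sets)
        qed (use sets_cylinder[OF Bs] sets_Q[OF that] in auto)
        also have "\<dots> = iterated K Bs y * indicator A y"
          using path[OF that] Bs by (simp add: is_path_measure_def)
        finally show ?thesis .
      qed
      then show ?thesis
        using sets_cylinder[OF As] space_K[OF x]
        by (simp add: emeasure_R Cons cong: nn_integral_cong_simp)
    qed
  qed
qed

lemma nn_integral_first_step:
  assumes x: "x \<in> space M" and h: "h \<in> borel_measurable (path_space M)"
  shows "(\<integral>\<^sup>+\<omega>. h \<omega> \<partial>Q x) = (\<integral>\<^sup>+y. (\<integral>\<^sup>+\<omega>. h (case_nat x \<omega>) \<partial>Q y) \<partial>K x)"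
proof -
  have sB: "sets (K x \<bind> Q) = sets (path_space M)"
    using sets_Q space_K[OF x] x by (intro sets_bind) auto
  have "(\<integral>\<^sup>+\<omega>. h \<omega> \<partial>Q x) = (\<integral>\<^sup>+\<omega>. h (case_nat x \<omega>) \<partial>(K x \<bind> Q))"
    unfolding first_step[OF x]
    using measurable_case_nat_path[OF x] h measurable_cong_sets[OF sB refl]
    by (intro nn_integral_distr) (auto intro: measurable_compose)
  also have "\<dots> = (\<integral>\<^sup>+y. (\<integral>\<^sup>+\<omega>. h (case_nat x \<omega>) \<partial>Q y) \<partial>K x)"
    using measurable_compose[OF measurable_case_nat_path[OF x] h] Q_K[OF x]
    by (rule nn_integral_bind)
  finally show ?thesis .
qed

lemma measurable_kernel_pair:
  assumes "h \<in> borel_measurable (M \<Otimes>\<^sub>M M)"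
  shows "(\<lambda>x. \<integral>\<^sup>+z. h (x, z) \<partial>K x) \<in> borel_measurable M"
  using assms K by (intro nn_integral_measurable_subprob_algebra2) auto

text \<open>
  Given \<open>X\<^sub>n\<close>, the next position has law \<open>K\<close> at \<open>X\<^sub>n\<close>.  The first-step decomposition passes from
  \<open>n\<close> to \<open>n + 1\<close>; for \<open>n = 0\<close> both sides are the integral of \<open>h(x, \<cdot>)\<close> against \<open>K x\<close>.
\<close>

lemma markov_property:
  assumes h: "h \<in> borel_measurable (M \<Otimes>\<^sub>M M)" and x: "x \<in> space M"
  shows "(\<integral>\<^sup>+\<omega>. h (X n \<omega>, X (Suc n) \<omega>) \<partial>Q x) = (\<integral>\<^sup>+\<omega>. (\<integral>\<^sup>+z. h (X n \<omega>, z) \<partial>K (X n \<omega>)) \<partial>Q x)"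
  using x
proof (induction n arbitrary: x)
  note [measurable] = h measurable_X
  case (0 x)
  have "(\<integral>\<^sup>+\<omega>. h (X 0 \<omega>, X (Suc 0) \<omega>) \<partial>Q x) = (\<integral>\<^sup>+y. (\<integral>\<^sup>+\<omega>. h (x, X 0 \<omega>) \<partial>Q y) \<partial>K x)"
    using 0 by (subst nn_integral_first_step) (simp_all add: X_case_nat)
  also have "\<dots> = (\<integral>\<^sup>+y. h (x, y) \<partial>K x)"
  proof (rule nn_integral_cong)
    fix y assume "y \<in> space (K x)"
    then have y: "y \<in> space M" using 0 space_K by simp
    have "(\<integral>\<^sup>+\<omega>. h (x, X 0 \<omega>) \<partial>Q y) = (\<integral>\<^sup>+\<omega>. h (x, y) \<partial>Q y)"
      using AE_start[OF y] by (intro nn_integral_cong_AE) (auto elim: eventually_mono)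
    then show "(\<integral>\<^sup>+\<omega>. h (x, X 0 \<omega>) \<partial>Q y) = h (x, y)"
      using prob_space.emeasure_space_1[OF prob_Q[OF y]] by simp
  qed
  also have "\<dots> = (\<integral>\<^sup>+\<omega>. (\<integral>\<^sup>+y. h (x, y) \<partial>K x) \<partial>Q x)"
    using prob_space.emeasure_space_1[OF prob_Q[OF 0]] by simp
  also have "\<dots> = (\<integral>\<^sup>+\<omega>. (\<integral>\<^sup>+z. h (X 0 \<omega>, z) \<partial>K (X 0 \<omega>)) \<partial>Q x)"
    using AE_start[OF 0] by (intro nn_integral_cong_AE) (auto elim: eventually_mono)
  finally show ?case .
next
  note [measurable] = h measurable_X measurable_compose[OF measurable_X measurable_kernel_pair[OF h]]
  case (Suc n x)
  have "(\<integral>\<^sup>+\<omega>. h (X (Suc n) \<omega>, X (Suc (Suc n)) \<omega>) \<partial>Q x)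
      = (\<integral>\<^sup>+y. (\<integral>\<^sup>+\<omega>. h (X n \<omega>, X (Suc n) \<omega>) \<partial>Q y) \<partial>K x)"
    using Suc.prems by (subst nn_integral_first_step) (simp_all add: X_case_nat)
  also have "\<dots> = (\<integral>\<^sup>+y. (\<integral>\<^sup>+\<omega>. (\<integral>\<^sup>+z. h (X n \<omega>, z) \<partial>K (X n \<omega>)) \<partial>Q y) \<partial>K x)"
    using Suc.IH space_K[OF Suc.prems] by (simp cong: nn_integral_cong_simp)
  also have "\<dots> = (\<integral>\<^sup>+\<omega>. (\<integral>\<^sup>+z. h (X (Suc n) \<omega>, z) \<partial>K (X (Suc n) \<omega>)) \<partial>Q x)"
    using Suc.prems by (subst nn_integral_first_step[where x=x]) (simp_all add: X_case_nat)
  finally show ?case .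
qed

text \<open>
  A function \<open>h\<close> with \<open>\<integral> h(y, z) K(y, dz) = 0\<close> for all \<open>y\<close> is a martingale difference when it is
  evaluated at consecutive positions.
\<close>

lemma integral_martingale_difference:
  fixes h :: "'a \<times> 'a \<Rightarrow> real"
  assumes h[measurable]: "h \<in> borel_measurable (M \<Otimes>\<^sub>M M)"
    and zero: "\<And>y. y \<in> space M \<Longrightarrow> (\<integral>z. h (y, z) \<partial>K y) = 0"
    and x: "x \<in> space M"
  shows "(\<integral>\<omega>. h (X n \<omega>, X (Suc n) \<omega>) \<partial>Q x) = 0"
proof -
  note [measurable] = measurable_X
  let ?pair = "\<lambda>\<omega>. (X n \<omega>, X (Suc n) \<omega>)"
  have Xn: "X n \<omega> \<in> space M" if "\<omega> \<in> space (Q x)" for \<omega>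
    using that measurable_space[OF measurable_X] space_Q[OF x] by blast
  have mX: "X n \<in> Q x \<rightarrow>\<^sub>M M" and mpair: "?pair \<in> Q x \<rightarrow>\<^sub>M M \<Otimes>\<^sub>M M"
    by (simp_all add: measurable_cong_sets[OF sets_Q[OF x] refl])
  define N where "N = (\<lambda>y. distr (K y) (M \<Otimes>\<^sub>M M) (Pair y))"
  have N: "N \<in> M \<rightarrow>\<^sub>M subprob_algebra (M \<Otimes>\<^sub>M M)"
    unfolding N_def using K by (rule measurable_distr2[rotated]) simp
  have Pair: "Pair y \<in> K y \<rightarrow>\<^sub>M M \<Otimes>\<^sub>M M" if "y \<in> space M" for y
    unfolding measurable_cong_sets[OF sets_K[OF that] refl]
    using that by (rule measurable_Pair1')
  have NX: "(\<lambda>\<omega>. N (X n \<omega>)) \<in> Q x \<rightarrow>\<^sub>M subprob_algebra (M \<Otimes>\<^sub>M M)"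
    using measurable_compose[OF mX N] .
  have "distr (Q x) (M \<Otimes>\<^sub>M M) ?pair = Q x \<bind> (\<lambda>\<omega>. N (X n \<omega>))" (is "?L = ?R")
  proof (rule measure_eqI)
    have ne: "space (Q x) \<noteq> {}" using prob_space.not_empty[OF prob_Q[OF x]] .
    have sR: "sets ?R = sets (M \<Otimes>\<^sub>M M)"
      using ne by (intro sets_bind) (auto simp: N_def)
    then show "sets ?L = sets ?R" by simp
    fix A assume "A \<in> sets ?L"
    then have A: "A \<in> sets (M \<Otimes>\<^sub>M M)" by simp
    have "emeasure ?L A = (\<integral>\<^sup>+p. indicator A p \<partial>?L)" using A by simp
    also have "\<dots> = (\<integral>\<^sup>+\<omega>. indicator A (?pair \<omega>) \<partial>Q x)"
      using A mpair by (intro nn_integral_distr) auto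
    also have "\<dots> = (\<integral>\<^sup>+\<omega>. (\<integral>\<^sup>+z. indicator A (X n \<omega>, z) \<partial>K (X n \<omega>)) \<partial>Q x)"
      using A x by (intro markov_property) auto
    also have "\<dots> = (\<integral>\<^sup>+\<omega>. (\<integral>\<^sup>+p. indicator A p \<partial>N (X n \<omega>)) \<partial>Q x)"
      unfolding N_def using A
      by (intro nn_integral_cong nn_integral_distr[symmetric] Pair Xn) auto
    also have "\<dots> = (\<integral>\<^sup>+p. indicator A p \<partial>?R)"
      using A by (intro nn_integral_bind[symmetric, OF _ NX]) auto
    also have "\<dots> = emeasure ?R A" using A sR by simp
    finally show "emeasure ?L A = emeasure ?R A" .
  qed
  then have "(\<integral>\<omega>. h (?pair \<omega>) \<partial>Q x) = (\<integral>p. h p \<partial>(Q x \<bind> (\<lambda>\<omega>. N (X n \<omega>))))"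
    using integral_distr[OF mpair h] by simp
  also have "\<dots> = 0"
  proof (rule integral_bind_eq_0[OF NX h])
    fix \<omega> assume "\<omega> \<in> space (Q x)"
    then show "(\<integral>p. h p \<partial>N (X n \<omega>)) = 0"
      unfolding N_def using integral_distr[OF Pair h] zero Xn by simp
  qed
  finally show ?thesis .
qed

text \<open>If \<open>\<nu>\<close> is invariant under \<open>K\<close>, then every \<open>X\<^sub>n\<close> has law \<open>\<nu>\<close> when \<open>X\<^sub>0\<close> does.\<close>

lemma nn_integral_X_invariant:
  assumes \<nu>: "sets \<nu> = sets M"
    and invariant: "\<And>u. u \<in> borel_measurable M \<Longrightarrow>
      (\<integral>\<^sup>+x. (\<integral>\<^sup>+y. u y \<partial>K x) \<partial>\<nu>) = (\<integral>\<^sup>+x. u x \<partial>\<nu>)"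
    and v: "v \<in> borel_measurable M"
  shows "(\<integral>\<^sup>+x. (\<integral>\<^sup>+\<omega>. v (X n \<omega>) \<partial>Q x) \<partial>\<nu>) = (\<integral>\<^sup>+x. v x \<partial>\<nu>)"
proof (induction n)
  have sp: "space \<nu> = space M" using \<nu> by (rule sets_eq_imp_space_eq)
  have m: "(\<lambda>\<omega>. v (X k \<omega>)) \<in> borel_measurable (path_space M)" for k
    using measurable_X v by (rule measurable_compose)
  case 0
  show ?case
  proof (rule nn_integral_cong)
    fix x assume "x \<in> space \<nu>"
    then have x: "x \<in> space M" using sp by simp
    have "(\<integral>\<^sup>+\<omega>. v (X 0 \<omega>) \<partial>Q x) = (\<integral>\<^sup>+\<omega>. v x \<partial>Q x)"
      using AE_start[OF x] by (intro nn_integral_cong_AE) (auto elim: eventually_mono)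
    then show "(\<integral>\<^sup>+\<omega>. v (X 0 \<omega>) \<partial>Q x) = v x"
      using prob_space.emeasure_space_1[OF prob_Q[OF x]] by simp
  qed
  case (Suc n)
  have "(\<integral>\<^sup>+x. (\<integral>\<^sup>+\<omega>. v (X (Suc n) \<omega>) \<partial>Q x) \<partial>\<nu>)
      = (\<integral>\<^sup>+x. (\<integral>\<^sup>+y. (\<integral>\<^sup>+\<omega>. v (X n \<omega>) \<partial>Q y) \<partial>K x) \<partial>\<nu>)"
    using sp m by (intro nn_integral_cong) (simp add: nn_integral_first_step X_case_nat)
  also have "\<dots> = (\<integral>\<^sup>+x. (\<integral>\<^sup>+\<omega>. v (X n \<omega>) \<partial>Q x) \<partial>\<nu>)"
    using m by (intro invariant measurable_nn_integral_Q)
  finally show ?case using Suc by simp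
qed

end


section \<open>Invariance of \<open>\<nu>\<close> and the Markov operator on \<open>L\<^sup>2\<close>\<close>

context symmetric_measure
begin

abbreviation \<nu> :: "'a measure" where "\<nu> \<equiv> nu_measure \<mu> \<kappa>"
abbreviation P :: "'a \<Rightarrow> 'a measure" where "P \<equiv> transition \<mu> \<kappa>"

sublocale path_kernel \<mu> P "path_measure \<mu> \<kappa>"
  by (rule path_kernel.intro)
     (rule measurable_transition prob_transition measurable_path_measure singleton path_measure,
       assumption?)+

lemma space_nu: "space \<nu> = space \<mu>"
  using sets_nu_measure by (rule sets_eq_imp_space_eq)

text \<open>Since \<open>\<nu>(dx) P(x, A) = \<kappa>\<^sub>x(A) \<mu>(dx)\<close>, the claim reads \<open>\<rho>(V \<times> A) = \<rho>(A \<times> V)\<close>.\<close>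

lemma bind_nu_transition: "\<nu> \<bind> P = \<nu>"
proof (rule measure_eqI)
  have ne: "space \<nu> \<noteq> {}" using space_nonempty space_nu by simp
  show sets_eq: "sets (\<nu> \<bind> P) = sets \<nu>"
    using ne sets_transition by (intro sets_bind[THEN trans, OF _ _ sets_nu_measure[symmetric]])
      (auto simp: space_nu)
  fix A assume "A \<in> sets (\<nu> \<bind> P)"
  then have A[measurable]: "A \<in> sets \<mu>" using sets_eq sets_nu_measure by simp
  have rho: "emeasure \<rho> (B \<times> C) = (\<integral>\<^sup>+x\<in>B. emeasure (\<kappa> x) C \<partial>\<mu>)"
    if B: "B \<in> sets \<mu>" and C: "C \<in> sets \<mu>" for B C
  proof -
    have "emeasure \<rho> (B \<times> C) = (\<integral>\<^sup>+z. indicator (B \<times> C) z \<partial>\<rho>)"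
      using B C sets_\<rho> by simp
    also have "\<dots> = (\<integral>\<^sup>+x. (\<integral>\<^sup>+y. indicator (B \<times> C) (x, y) \<partial>\<kappa> x) \<partial>\<mu>)"
      using B C by (intro disintegration) simp
    also have "\<dots> = (\<integral>\<^sup>+x\<in>B. emeasure (\<kappa> x) C \<partial>\<mu>)"
      using C sets_\<kappa>
      by (intro nn_integral_cong) (simp add: indicator_times nn_integral_cmult_indicator mult.commute)
    finally show ?thesis .
  qed
  have mP: "(\<lambda>x. emeasure (P x) A) \<in> borel_measurable \<mu>"
    using A by (intro measurable_emeasure_kernel[OF measurable_transition])
  have "emeasure (\<nu> \<bind> P) A = (\<integral>\<^sup>+x. emeasure (P x) A \<partial>\<nu>)"
    using ne A measurable_transition measurable_cong_sets[OF sets_nu_measure refl]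
    by (intro emeasure_bind) auto
  also have "\<dots> = (\<integral>\<^sup>+x. c_fun \<mu> \<kappa> x * emeasure (P x) A \<partial>\<mu>)"
    unfolding nu_measure_def using c_measurable mP by (rule nn_integral_density)
  also have "\<dots> = (\<integral>\<^sup>+x\<in>space \<mu>. emeasure (\<kappa> x) A \<partial>\<mu>)"
  proof (rule nn_integral_cong_AE)
    show "AE x in \<mu>. c_fun \<mu> \<kappa> x * emeasure (P x) A = emeasure (\<kappa> x) A * indicator (space \<mu>) x"
      using c_pos_finite AE_space
    proof eventually_elim
      case (elim x)
      have "c_fun \<mu> \<kappa> x * (inverse (c_fun \<mu> \<kappa> x) * emeasure (\<kappa> x) A) = emeasure (\<kappa> x) A"
        using elim ennreal_divide_self[of "c_fun \<mu> \<kappa> x"]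
        by (auto simp: divide_ennreal_def mult.assoc[symmetric])
      then show ?case using elim by (simp add: transition_def)
    qed
  qed
  also have "\<dots> = emeasure \<rho> (space \<mu> \<times> A)" by (simp add: rho)
  also have "\<dots> = emeasure \<rho> (A \<times> space \<mu>)" by (intro symmetric) simp_all
  also have "\<dots> = (\<integral>\<^sup>+x\<in>A. c_fun \<mu> \<kappa> x \<partial>\<mu>)" by (simp add: rho c_fun_def)
  also have "\<dots> = emeasure \<nu> A"
    unfolding nu_measure_def using c_measurable by (simp add: emeasure_density)
  finally show "emeasure (\<nu> \<bind> P) A = emeasure \<nu> A" .
qed

lemma nn_integral_nu_invariant:
  assumes "u \<in> borel_measurable \<mu>"
  shows "(\<integral>\<^sup>+x. (\<integral>\<^sup>+y. u y \<partial>P x) \<partial>\<nu>) = (\<integral>\<^sup>+x. u x \<partial>\<nu>)"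
proof -
  have "P \<in> \<nu> \<rightarrow>\<^sub>M subprob_algebra \<mu>"
    using measurable_transition measurable_cong_sets[OF sets_nu_measure refl] by blast
  from nn_integral_bind[OF assms this] show ?thesis by (simp add: bind_nu_transition)
qed

lemma measurable_markov_op:
  assumes "f \<in> borel_measurable \<mu>"
  shows "markov_op \<mu> \<kappa> f \<in> borel_measurable \<mu>"
  unfolding markov_op_def[abs_def]
  using measurable_compose[OF measurable_transition integral_measurable_subprob_algebra[OF assms]] .

text \<open>
  Jensen's inequality gives \<open>(P f)\<^sup>2 \<le> P (f\<^sup>2)\<close> pointwise, and \<open>P (f\<^sup>2)\<close> has the same
  \<open>\<nu>\<close>-integral as \<open>f\<^sup>2\<close>.
\<close>

lemma markov_op_L2:
  assumes "f \<in> L2 \<nu>"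
  shows "markov_op \<mu> \<kappa> f \<in> L2 \<nu>"
proof -
  have f: "f \<in> borel_measurable \<mu>" and fin: "(\<integral>\<^sup>+x. ennreal ((f x)\<^sup>2) \<partial>\<nu>) < \<infinity>"
    using assms measurable_cong_sets[OF sets_nu_measure refl] by (auto simp: L2_iff_nn_integral)
  have "(\<integral>\<^sup>+x. ennreal ((markov_op \<mu> \<kappa> f x)\<^sup>2) \<partial>\<nu>) \<le> (\<integral>\<^sup>+x. (\<integral>\<^sup>+y. ennreal ((f y)\<^sup>2) \<partial>P x) \<partial>\<nu>)"
    unfolding markov_op_def
  proof (intro nn_integral_mono prob_space.square_integral_le_nn_integral_square)
    fix x assume "x \<in> space \<nu>"
    then have x: "x \<in> space \<mu>" by (simp add: space_nu)
    then show "prob_space (P x)" by (rule prob_transition)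
    show "f \<in> borel_measurable (P x)"
      using f measurable_cong_sets[OF sets_transition[OF x] refl] by blast
  qed
  also have "\<dots> = (\<integral>\<^sup>+x. ennreal ((f x)\<^sup>2) \<partial>\<nu>)"
    using f by (intro nn_integral_nu_invariant) measurable
  finally have "(\<integral>\<^sup>+x. ennreal ((markov_op \<mu> \<kappa> f x)\<^sup>2) \<partial>\<nu>) < \<infinity>"
    using fin by (rule le_less_trans)
  then show ?thesis
    using measurable_markov_op[OF f] measurable_cong_sets[OF sets_nu_measure refl]
    by (auto simp: L2_iff_nn_integral)
qed


section \<open>Orthogonality in the dissipation space\<close>

lemma comp_X_in_Diss:
  assumes "g \<in> L2 \<nu>"
  shows "g \<circ> X n \<in> Diss \<mu> \<kappa>"
proof -
  have g[measurable]: "g \<in> borel_measurable \<mu>" and fin: "(\<integral>\<^sup>+x. ennreal ((g x)\<^sup>2) \<partial>\<nu>) < \<infinity>"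
    using assms measurable_cong_sets[OF sets_nu_measure refl] by (auto simp: L2_iff_nn_integral)
  note [measurable] = measurable_X
  have Q: "path_measure \<mu> \<kappa> \<in> \<nu> \<rightarrow>\<^sub>M subprob_algebra (path_space \<mu>)"
    using measurable_path_measure measurable_cong_sets[OF sets_nu_measure refl] by blast
  have "(\<integral>\<^sup>+\<omega>. ennreal ((g (X n \<omega>))\<^sup>2) \<partial>path_lambda \<mu> \<kappa>)
      = (\<integral>\<^sup>+x. (\<integral>\<^sup>+\<omega>. ennreal ((g (X n \<omega>))\<^sup>2) \<partial>path_measure \<mu> \<kappa> x) \<partial>\<nu>)"
    unfolding path_lambda_def by (rule nn_integral_bind[OF _ Q]) measurable
  also have "\<dots> = (\<integral>\<^sup>+x. ennreal ((g x)\<^sup>2) \<partial>\<nu>)"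
    by (rule nn_integral_X_invariant[OF sets_nu_measure nn_integral_nu_invariant]) simp_all
  finally have "(\<integral>\<^sup>+\<omega>. ennreal ((g (X n \<omega>))\<^sup>2) \<partial>path_lambda \<mu> \<kappa>) < \<infinity>"
    using fin by simp
  moreover have "(\<lambda>\<omega>. g (X n \<omega>)) \<in> borel_measurable (path_lambda \<mu> \<kappa>)"
    by (simp add: measurable_cong_sets[OF sets_path_lambda refl])
  ultimately show ?thesis
    by (simp add: Diss_def L2_iff_nn_integral comp_def)
qed

text \<open>
  Already the inner integral vanishes, for every starting point, because
  \<open>g(y) (P f(y) - f(z))\<close> integrates to \<open>0\<close> against \<open>P(y, dz)\<close>.
\<close>

lemma Diss_inner_markov_increment:
  assumes g[measurable]: "g \<in> borel_measurable \<mu>" and f[measurable]: "f \<in> borel_measurable \<mu>"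
  shows "Diss_inner \<mu> \<kappa> (g \<circ> X n) (\<lambda>\<omega>. (markov_op \<mu> \<kappa> f \<circ> X n) \<omega> - (f \<circ> X (Suc n)) \<omega>) = 0"
proof -
  note [measurable] = measurable_markov_op[OF f] measurable_X
  define h where "h = (\<lambda>(y, z). g y * (markov_op \<mu> \<kappa> f y - f z))"
  have h: "h \<in> borel_measurable (\<mu> \<Otimes>\<^sub>M \<mu>)"
    unfolding h_def by measurable
  have zero: "(\<integral>z. h (y, z) \<partial>P y) = 0" if y: "y \<in> space \<mu>" for y
  proof (cases "integrable (P y) f")
    case True
    then show ?thesis
      using prob_space.prob_space[OF prob_transition[OF y]] prob_transition[OF y]
      by (simp add: h_def markov_op_def prob_space.finite_measure finite_measure.integrable_const)
  next
    case False
    \<comment> \<open>Here \<open>P f(y)\<close> is \<open>0\<close> by convention; the integrand is then \<open>- g(y) f\<close>, which is either \<open>0\<close>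
      or not integrable.\<close>
    then show ?thesis
      by (simp add: h_def markov_op_def not_integrable_integral_eq)
  qed
  have "(LINT \<omega>:paths_from \<mu> x|path_measure \<mu> \<kappa> x.
      (g \<circ> X n) \<omega> * ((markov_op \<mu> \<kappa> f \<circ> X n) \<omega> - (f \<circ> X (Suc n)) \<omega>)) = 0"
    if x: "x \<in> space \<mu>" for x
  proof -
    have pf: "paths_from \<mu> x \<in> sets (path_space \<mu>)"
      using singleton[OF x] by (rule sets_paths_from)
    have "(LINT \<omega>:paths_from \<mu> x|path_measure \<mu> \<kappa> x.
        (g \<circ> X n) \<omega> * ((markov_op \<mu> \<kappa> f \<circ> X n) \<omega> - (f \<circ> X (Suc n)) \<omega>))
        = (\<integral>\<omega>. h (X n \<omega>, X (Suc n) \<omega>) \<partial>path_measure \<mu> \<kappa> x)"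
      unfolding set_lebesgue_integral_def
    proof (rule integral_cong_AE)
      show "AE \<omega> in path_measure \<mu> \<kappa> x. indicat_real (paths_from \<mu> x) \<omega> *\<^sub>R
          ((g \<circ> X n) \<omega> * ((markov_op \<mu> \<kappa> f \<circ> X n) \<omega> - (f \<circ> X (Suc n)) \<omega>))
          = h (X n \<omega>, X (Suc n) \<omega>)"
        using AE_paths_from[OF x] by eventually_elim (simp add: h_def)
    qed (use pf h in \<open>simp_all add: measurable_cong_sets[OF sets_Q[OF x] refl] comp_def\<close>)
    also have "\<dots> = 0"
      using h zero x by (rule integral_martingale_difference)
    finally show ?thesis .
  qed
  then have "Diss_inner \<mu> \<kappa> (g \<circ> X n) (\<lambda>\<omega>. (markov_op \<mu> \<kappa> f \<circ> X n) \<omega> - (f \<circ> X (Suc n)) \<omega>)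
      = 1/2 * (\<integral>x. 0 \<partial>\<nu>)"
    unfolding Diss_inner_def
    by (intro arg_cong[where f="\<lambda>t. 1/2 * t"] Bochner_Integration.integral_cong)
       (simp_all add: space_nu)
  then show ?thesis by simp
qed

end

theorem proposition5p7:
  fixes \<mu> :: "'a measure" and \<rho> :: "('a \<times> 'a) measure" and E :: "('a \<times> 'a) set"
    and \<kappa> :: "'a \<Rightarrow> 'a measure" and f :: "'a \<Rightarrow> real" and n :: nat
  assumes "symmetric_measure \<mu> \<rho> E \<kappa>"
    and "f \<in> L2 (nu_measure \<mu> \<kappa>)"
  shows "Diss_orthogonal \<mu> \<kappa>
           ((\<lambda>x. f x - markov_op \<mu> \<kappa> f x) \<circ> X n)
           (\<lambda>\<omega>. (markov_op \<mu> \<kappa> f \<circ> X n) \<omega> - (f \<circ> X (Suc n)) \<omega>)"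
proof -
  interpret symmetric_measure \<mu> \<rho> E \<kappa> by fact
  have f[measurable]: "f \<in> borel_measurable \<mu>"
    using assms(2) measurable_cong_sets[OF sets_nu_measure refl] by (auto simp: L2_def)
  note [measurable] = measurable_markov_op[OF f]
  have "(\<lambda>x. f x - markov_op \<mu> \<kappa> f x) \<circ> X n \<in> Diss \<mu> \<kappa>"
    using assms(2) by (intro comp_X_in_Diss L2_diff markov_op_L2)
  moreover have "(\<lambda>\<omega>. (markov_op \<mu> \<kappa> f \<circ> X n) \<omega> - (f \<circ> X (Suc n)) \<omega>) \<in> Diss \<mu> \<kappa>"
    using comp_X_in_Diss[OF markov_op_L2[OF assms(2)]] comp_X_in_Diss[OF assms(2)]
    unfolding Diss_def by (rule L2_diff)
  moreover have "Diss_inner \<mu> \<kappa> ((\<lambda>x. f x - markov_op \<mu> \<kappa> f x) \<circ> X n)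
      (\<lambda>\<omega>. (markov_op \<mu> \<kappa> f \<circ> X n) \<omega> - (f \<circ> X (Suc n)) \<omega>) = 0"
    by (rule Diss_inner_markov_increment) measurable
  ultimately show ?thesis
    by (simp add: Diss_orthogonal_def)
qed

end
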